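(* Let $\mathcal S$ be a state space, $(\mathcal A,d_{\mathcal A})$ a metric action space, and fix $s\in\mathcal S$ and $\tau\in(0,1)$. Let $C_1(s),\dots,C_{\mathsf K(s)}(s)\subseteq\mathcal A$ be the modes of a multimodal conditional action distribution $p_{\mathcal D}(\cdot\mid s)$, with separation $\Delta(s)>0$ (see context). Assume that the transport map $G_{\theta,s}:\mathbb R\to\mathcal A$, $u\mapsto G_\theta(s,u)$, is $L_{\theta,s}$-Lipschitz, and let $\pi_\theta(\cdot\mid s)=(G_{\theta,s})_{\#}\mathcal N(0,1)$. Let $$N_\theta^{(\tau)}(s):=\Big|\big\{k\in\{1,\dots,\mathsf K(s)\}:\ \pi_\theta(C_k(s)\mid s)>\tau\big\}\Big|$$ be the number of modes that are $\tau$-represented by $\pi_\theta(\cdot\mid s)$. Then $$N_\theta^{(\tau)}(s)\ \le\ 1+\left\lfloor\frac{2\,\Phi^{-1}\!\left(1-\frac{\tau}{2}\right)L_{\theta,s}}{\Delta(s)}\right\rfloor,$$ where $\Phi^{-1}$ is the quantile function of the standard normal distribution.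
   Context: Multimodal structure at $s$: $\mathsf K(s)\ge 1$ is a natural number and $C_1(s),\dots,C_{\mathsf K(s)}(s)\subseteq\mathcal A$ are (measurable) sets such that $\operatorname{supp}p_{\mathcal D}(\cdot\mid s)\subseteq\bigcup_{k=1}^{\mathsf K(s)}C_k(s)$ and $$\Delta(s):=\min_{k\neq k'}\operatorname{dist}_{\mathcal A}\big(C_k(s),C_{k'}(s)\big)>0,\qquad \operatorname{dist}_{\mathcal A}(B,C)=\inf_{b\in B,\,c\in C}d_{\mathcal A}(b,c).$$ (When $\mathsf K(s)=1$ the minimum is over an empty set and is read as $+\infty$, so that the fraction in the bound is $0$.) The policy $\pi_\theta(\cdot\mid s)$ is the push-forward of the one-dimensional standard Gaussian: $\pi_\theta(B\mid s)=\Pr_{U\sim\mathcal N(0,1)}(G_\theta(s,U)\in B)$ for measurable $B\subseteq\mathcal A$. A mode $C_k(s)$ is called $\tau$-represented if $\pi_\theta(C_k(s)\mid s)>\tau$. $L_{\theta,s}$-Lipschitz means $d_{\mathcal A}(G_{\theta,s}(u),G_{\theta,s}(u'))\le L_{\theta,s}|u-u'|$ for all $u,u'\in\mathbb R$. *)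

theory Defs
  imports "HOL-Probability.Probability"
begin

definition measure_supp :: "'a::topological_space measure \<Rightarrow> 'a set" where
  "measure_supp M = {x. \<forall>U. open U \<longrightarrow> x \<in> U \<longrightarrow> 0 < emeasure M U}"

(* The values are extended reals so that an infimum over an empty index set is
   infinity; the library's setdist would be 0 there. *)
definition set_distance :: "'a::metric_space set \<Rightarrow> 'a set \<Rightarrow> ereal" where
  "set_distance B C = (INF b\<in>B. INF c\<in>C. ereal (dist b c))"

(* For K = 1 there are no pairs and the separation is infinity; for K > 1 the
   infimum ranges over a finite nonempty index set and is a minimum. *)
definition mode_separation :: "nat \<Rightarrow> (nat \<Rightarrow> 'a::metric_space set) \<Rightarrow> ereal" where
  "mode_separation K C =
     (INF (k, k') \<in> {(k, k'). k \<in> {1..K} \<and> k' \<in> {1..K} \<and> k \<noteq> k'}. set_distance (C k) (C k'))"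

definition policy ::
  "('p \<Rightarrow> 's \<Rightarrow> real \<Rightarrow> 'a::metric_space) \<Rightarrow> 'p \<Rightarrow> 's \<Rightarrow> 'a measure" where
  "policy G \<theta> s = distr std_normal_distribution borel (G \<theta> s)"

definition num_represented :: "'a measure \<Rightarrow> nat \<Rightarrow> (nat \<Rightarrow> 'a set) \<Rightarrow> real \<Rightarrow> nat" where
  "num_represented M K C \<tau> = card {k \<in> {1..K}. measure M (C k) > \<tau>}"

(* Generalized inverse of the distribution function; used for 0 < p < 1 only. *)
definition quantile :: "real measure \<Rightarrow> real \<Rightarrow> real" where
  "quantile M p = Inf {x. p \<le> cdf M x}"

end

theory Submission
  imports Defs
begin

text \<open>All but mass \<open>\<tau>\<close> of the standard normal law lies in \<open>[-q, q]\<close>, where \<open>q\<close> is its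
  \<open>(1 - \<tau>/2)\<close>-quantile, so the preimage under \<open>G\<close> of every \<open>\<tau>\<close>-represented mode meets this interval.
  After scaling by \<open>L\<close>, points of the interval chosen for different modes are at least the
  separation apart, and an interval of length \<open>2 q L\<close> has room for only so many of them.\<close>

text \<open>Points are added in increasing order: each new maximum lies at least \<open>d\<close>
  beyond the previous one, so the spread grows by at least \<open>d\<close> per point after the
  first.\<close>

lemma card_separated_le_diameter:
  fixes X :: "real set"
  assumes "finite X" and "X \<noteq> {}"
    and "\<And>x y. \<lbrakk>x \<in> X; y \<in> X; x \<noteq> y\<rbrakk> \<Longrightarrow> d \<le> \<bar>x - y\<bar>"
  shows "(real (card X) - 1) * d \<le> Max X - Min X"
  using assms
proof (induction X rule: finite_linorder_max_induct)
  case empty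
  then show ?case by simp
next
  case (insert b A)
  show ?case
  proof (cases "A = {}")
    case True
    then show ?thesis by simp
  next
    case False
    have "(real (card A) - 1) * d \<le> Max A - Min A"
      using insert False by blast
    moreover have "Max A \<in> A" using insert False by simp
    moreover from this have "Max A < b" using insert by blast
    moreover have "d \<le> b - Max A"
      using insert.prems(2)[of b "Max A"] calculation by auto
    moreover have "Max (insert b A) = b"
      using insert.hyps by (intro Max_eqI) (auto intro: less_imp_le)
    moreover have "Min (insert b A) = Min A"
    proof -
      have "Min A < b" using insert.hyps False by simp
      then show ?thesis
        using insert.hyps False by (simp add: min.absorb2 del: Min_less_iff)
    qed
    moreover have "card (insert b A) = Suc (card A)"
      using insert.hyps by (auto simp: card_insert_if)
    ultimately show ?thesis by (simp add: algebra_simps)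
  qed
qed

text \<open>The limits of the distribution function at both ends make the set under
  \<open>Inf\<close> nonempty and bounded below, so the infimum is genuine. Right continuity then
  carries the inequality over to it.\<close>

lemma cdf_quantile_ge:
  assumes "real_distribution M" and "0 < p" and "p < 1"
  shows "p \<le> cdf M (quantile M p)"
proof -
  interpret real_distribution M by fact
  define S where "S = {x. p \<le> cdf M x}"
  have "eventually (\<lambda>x. p < cdf M x) at_top"
    using order_tendstoD(1)[OF cdf_lim_at_top_prob \<open>p < 1\<close>] .
  then obtain a where "p < cdf M a"
    by (auto simp: eventually_at_top_linorder)
  then have ne: "S \<noteq> {}" by (auto simp: S_def intro: less_imp_le)
  have "eventually (\<lambda>x. cdf M x < p) at_bot"
    using order_tendstoD(2)[OF cdf_lim_at_bot \<open>0 < p\<close>] .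
  then obtain b where b: "cdf M b < p"
    by (auto simp: eventually_at_bot_linorder)
  have bdd: "bdd_below S"
  proof (rule bdd_belowI)
    fix x assume "x \<in> S"
    then show "b \<le> x"
      using b cdf_nondecreasing[of x b] by (force simp: S_def)
  qed
  have "((cdf M) \<longlongrightarrow> cdf M (Inf S)) (at_right (Inf S))"
    using cdf_is_right_cont[of "Inf S"] by (simp add: continuous_within)
  \<comment> \<open>Some element of \<open>S\<close> lies below any such \<open>x\<close>, and
    monotonicity passes its bound on to \<open>x\<close>.\<close>
  moreover have "p \<le> cdf M x" if x: "Inf S < x" for x
  proof -
    obtain y where "y \<in> S" "y < x"
      using cInf_lessD[OF ne x] by blast
    then show ?thesis
      using cdf_nondecreasing[of y x] by (simp add: S_def)
  qed
  then have "eventually (\<lambda>x. p \<le> cdf M x) (at_right (Inf S))"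
    by (auto simp: eventually_at_filter)
  ultimately have "p \<le> cdf M (Inf S)"
    by (rule tendsto_lowerbound) simp
  then show ?thesis by (simp add: quantile_def S_def)
qed

text \<open>Reflection is the affine map with factor -1 and shift 0; it sends mean 0 to 0 and
  standard deviation 1 to \<open>\<bar>-1\<bar> * 1\<close>.\<close>

lemma distr_uminus_std_normal:
  "distr std_normal_distribution borel uminus = std_normal_distribution"
proof -
  interpret prob_space std_normal_distribution
    by (rule prob_space_normal_density) simp
  have "distributed std_normal_distribution lborel (\<lambda>x. x) std_normal_density"
    by (simp add: distributed_def distr_id2)
  from normal_density_affine[OF this, of "-1" 0]
  have "distr std_normal_distribution lborel uminus = std_normal_distribution"
    by (simp add: distributed_def)
  then show ?thesis
    by (metis distr_cong sets_lborel)
qed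

text \<open>The choice of quantile leaves at most \<open>\<tau> / 2\<close> above \<open>q\<close>;
  by symmetry the lower tail has the same mass.\<close>

lemma std_normal_tails_le:
  assumes "0 < \<tau>" and "\<tau> < 1"
  defines "q \<equiv> quantile std_normal_distribution (1 - \<tau> / 2)"
  shows "measure std_normal_distribution (- {-q..q}) \<le> \<tau>"
proof -
  interpret real_distribution std_normal_distribution
    by (rule real_dist_normal_dist)
  let ?M = std_normal_distribution
  have "1 - \<tau> / 2 \<le> cdf ?M q"
    unfolding q_def using assms(1,2)
    by (intro cdf_quantile_ge real_dist_normal_dist) auto
  moreover have "measure ?M {q<..} = 1 - cdf ?M q"
    using prob_compl[of "{..q}"] by (simp add: cdf_def Compl_eq_Diff_UNIV[symmetric])
  ultimately have upper: "measure ?M {q<..} \<le> \<tau> / 2" by simp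
  have "measure ?M {..<-q} = measure (distr ?M borel uminus) {..<-q}"
    by (simp add: distr_uminus_std_normal)
  also have "\<dots> = measure ?M (uminus -` {..<-q} \<inter> space ?M)"
    by (rule measure_distr) auto
  also have "uminus -` {..<-q} \<inter> space ?M = {q<..}" by auto
  finally have lower: "measure ?M {..<-q} \<le> \<tau> / 2" using upper by simp
  have "- {-q..q} = {..<-q} \<union> {q<..}" by auto
  then have "measure ?M (- {-q..q}) \<le> measure ?M {..<-q} + measure ?M {q<..}"
    by (simp add: measure_Un_le)
  with upper lower show ?thesis by simp
qed

lemma mode_separation_le_dist:
  assumes "k \<in> {1..K}" and "k' \<in> {1..K}" and "k \<noteq> k'" and "b \<in> C k" and "c \<in> C k'"
  shows "mode_separation K C \<le> ereal (dist b c)"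
proof -
  have "mode_separation K C \<le> set_distance (C k) (C k')"
    unfolding mode_separation_def using assms
    by (intro INF_lower2[of "(k, k')"]) auto
  also have "\<dots> \<le> ereal (dist b c)"
    unfolding set_distance_def using assms
    by (intro INF_lower2[of b] INF_lower2[of c]) auto
  finally show ?thesis .
qed

theorem proposition2:
  fixes s :: 's
    and \<theta> :: 'p
    and \<tau> L :: real
    and K :: "'s \<Rightarrow> nat"
    and C :: "'s \<Rightarrow> nat \<Rightarrow> 'a::metric_space set"
    and p\<^sub>D :: "'s \<Rightarrow> 'a measure"
    and G :: "'p \<Rightarrow> 's \<Rightarrow> real \<Rightarrow> 'a"
  assumes "0 < \<tau>" and "\<tau> < 1"
    and "prob_space (p\<^sub>D s)" and "sets (p\<^sub>D s) = sets borel"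
    and "1 \<le> K s"
    and "\<And>k. k \<in> {1..K s} \<Longrightarrow> C s k \<in> sets borel"
    and "measure_supp (p\<^sub>D s) \<subseteq> (\<Union>k\<in>{1..K s}. C s k)"
    and "0 < mode_separation (K s) (C s)"
    and "L-lipschitz_on UNIV (G \<theta> s)"
  shows "int (num_represented (policy G \<theta> s) (K s) (C s) \<tau>)
    \<le> 1 + \<lfloor>real_of_ereal
          (ereal (2 * quantile std_normal_distribution (1 - \<tau> / 2) * L)
             / mode_separation (K s) (C s))\<rfloor>"
proof -
  let ?N = std_normal_distribution
  interpret N: real_distribution ?N
    by (rule real_dist_normal_dist)
  define q where "q = quantile ?N (1 - \<tau> / 2)"
  define \<Delta> where "\<Delta> = mode_separation (K s) (C s)"
  define R where "R = {k \<in> {1..K s}. measure (policy G \<theta> s) (C s k) > \<tau>}"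
  note lip = \<open>L-lipschitz_on UNIV (G \<theta> s)\<close>
  have L: "0 \<le> L" using lip by (rule lipschitz_on_nonneg)
  have tails: "measure ?N (- {-q..q}) \<le> \<tau>"
    unfolding q_def using assms(1,2) by (rule std_normal_tails_le)
  \<comment> \<open>For negative \<open>q\<close> the interval would be empty and its complement
    would have mass 1, exceeding \<tau>.\<close>
  have "0 \<le> q"
  proof (rule ccontr)
    assume "\<not> 0 \<le> q"
    then have "- {-q..q} = UNIV" by auto
    then show False
      using tails N.prob_space \<open>\<tau> < 1\<close> by simp
  qed
  have G: "G \<theta> s \<in> borel_measurable ?N"
    using lipschitz_on_continuous_on[OF lip] by (simp add: borel_measurable_continuous_onI)
  have "\<exists>u \<in> {-q..q}. G \<theta> s u \<in> C s k" if "k \<in> R" for k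
  proof (rule ccontr)
    assume none: "\<not> (\<exists>u \<in> {-q..q}. G \<theta> s u \<in> C s k)"
    have "C s k \<in> sets borel" using that assms(6) by (auto simp: R_def)
    then have "measure (policy G \<theta> s) (C s k) = measure ?N (G \<theta> s -` C s k \<inter> space ?N)"
      unfolding policy_def by (rule measure_distr[OF G])
    also have "\<dots> \<le> measure ?N (- {-q..q})"
      using none by (intro N.finite_measure_mono) auto
    finally show False using tails that by (simp add: R_def)
  qed
  then obtain u where u: "\<And>k. k \<in> R \<Longrightarrow> u k \<in> {-q..q}" "\<And>k. k \<in> R \<Longrightarrow> G \<theta> s (u k) \<in> C s k"
    by metis
  \<comment> \<open>Scaling the points by \<open>L\<close>, instead of dividing the separation by
    \<open>L\<close>, also covers \<open>L = 0\<close>.\<close>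
  have sep: "\<Delta> \<le> ereal \<bar>L * u k - L * u k'\<bar>" if "k \<in> R" "k' \<in> R" "k \<noteq> k'" for k k'
  proof -
    have "\<Delta> \<le> ereal (dist (G \<theta> s (u k)) (G \<theta> s (u k')))"
      unfolding \<Delta>_def using that u(2)
      by (intro mode_separation_le_dist) (auto simp: R_def)
    also have "dist (G \<theta> s (u k)) (G \<theta> s (u k')) \<le> L * dist (u k) (u k')"
      using lip by (rule lipschitz_onD) auto
    also have "\<dots> = \<bar>L * u k - L * u k'\<bar>"
      using L by (simp add: dist_real_def abs_mult flip: right_diff_distrib)
    finally show ?thesis by simp
  qed
  have "int (card R) \<le> 1 + \<lfloor>real_of_ereal (ereal (2 * q * L) / \<Delta>)\<rfloor>"
  proof (cases \<Delta>)
    case (real d)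
    have d: "0 < d" using assms(8) real by (simp add: \<Delta>_def)
    have "(real (card R) - 1) * d \<le> 2 * q * L"
    proof (cases "R = {}")
      \<comment> \<open>Here the left side is \<open>- d\<close>, so nonnegativity of the right
        side, and hence of \<open>q\<close>, suffices.\<close>
      case True
      have "0 \<le> 2 * q * L" using \<open>0 \<le> q\<close> L by simp
      with d have "- d \<le> 2 * q * L" by linarith
      then show ?thesis using True by simp
    next
      case False
      define X where "X = (\<lambda>k. L * u k) ` R"
      \<comment> \<open>Distinct modes give points at least \<open>d > 0\<close> apart, so
        \<open>X\<close> has as many elements as \<open>R\<close>.\<close>
      have inj: "inj_on (\<lambda>k. L * u k) R"
        using sep d real by (force intro!: inj_onI)
      have X: "finite X" "X \<noteq> {}" using False by (auto simp: X_def R_def)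
      have "(real (card X) - 1) * d \<le> Max X - Min X"
        using X sep real by (intro card_separated_le_diameter) (auto simp: X_def)
      also have "\<dots> \<le> 2 * q * L"
      proof -
        have "X \<subseteq> {L * (-q)..L * q}"
          unfolding X_def
        proof (rule image_subsetI)
          fix k assume "k \<in> R"
          then have "-q \<le> u k" "u k \<le> q" using u(1) by auto
          then show "L * u k \<in> {L * (-q)..L * q}"
            using L by (simp only: atLeastAtMost_iff mult_left_mono simp_thms)
        qed
        then have "Max X \<le> L * q" and "L * (-q) \<le> Min X"
          using Max_in[OF X] Min_in[OF X] by (meson atLeastAtMost_iff subsetD)+
        then show ?thesis by (simp add: algebra_simps)
      qed
      finally show ?thesis by (simp add: X_def card_image[OF inj])
    qed
    then have "real (card R) - 1 \<le> 2 * q * L / d"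
      using d by (simp add: pos_le_divide_eq)
    then have "int (card R) - 1 \<le> \<lfloor>2 * q * L / d\<rfloor>"
      by (simp add: le_floor_iff)
    then show ?thesis using real d by simp
  next
    \<comment> \<open>This occurs when at most one mode is nonempty, in particular for a single
      mode. Two represented modes would be at finite distance, so there is at most one; the fraction
      is 0 and the bound is 1.\<close>
    case PInf
    then have "k = k'" if "k \<in> R" "k' \<in> R" for k k'
      using sep that by fastforce
    then have "card R \<le> 1"
      by (simp add: R_def card_le_Suc0_iff_eq)
    then show ?thesis using PInf by simp
  next
    case MInf
    then show ?thesis using assms(8) by (simp add: \<Delta>_def)
  qed
  then show ?thesis
    by (simp add: num_represented_def R_def q_def \<Delta>_def)
qed

end
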